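(* Let $\mathrm{pps}>0$ be the packet generation rate (packets per second) and $T>0$ the horizon length (seconds), so that $N_{\mathrm{pkt}}=\mathrm{pps}\,T$ packets are generated. Let $L_{\mathrm{bits}}>0$ be the payload length (bits), $R>0$ the data rate (bits per second), $P_t>0$ the transmit power, $H\in\mathbb{N}$, $H\ge 1$, the maximum number of transmission attempts per generated packet, and $\mathrm{PRR}\in(0,1]$ the success probability of each attempt. Let $P_c\ge 0$ denote the additional averaged circuit power consumed during transmission, and let $P_i\ge 0$ denote the averaged platform idle power over the horizon $T$. Then the expected total communication energy over the horizon is $$E_{\mathrm{comm}}=N_{\mathrm{pkt}}\left[(P_t+P_c)\,\frac{L_{\mathrm{bits}}}{R}\;\frac{1-(1-\mathrm{PRR})^{H}}{\mathrm{PRR}}+\frac{P_i}{\mathrm{pps}}\right].$$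
   Context: Transmission model (truncated HARQ): for each generated packet, transmission attempts are made one after another until the first correct reception or until $H$ attempts have been made, whichever comes first. Attempts are independent and identically distributed, each being successful with probability $\mathrm{PRR}$ (packet reception ratio). Each attempt lasts $L_{\mathrm{bits}}/R$ seconds, during which transmit power $P_t$ and circuit power $P_c$ are both consumed, so each attempt consumes energy $(P_t+P_c)L_{\mathrm{bits}}/R$. In addition, the platform consumes idle power $P_i$ over the entire horizon, i.e. idle energy $P_i T$. The total communication energy over the horizon is the sum of the energies of all attempts actually made for all $N_{\mathrm{pkt}}$ (taken to be a nonnegative integer) generated packets, plus the idle energy $P_iT$; $E_{\mathrm{comm}}$ denotes its expectation. *)

theory Defs
  imports "HOL-Probability.Probability"
begin

text \<open>
  Attempts for a packet are numbered from 1, and \<^term>\<open>s k\<close> says whether the \<^term>\<open>k\<close>-th attempt is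
  (or would be, if it were made) received correctly. The set below always contains \<^term>\<open>H\<close> when
  \<^term>\<open>H \<ge> 1\<close>, so the least element exists.
\<close>

definition attempts_made :: "nat \<Rightarrow> (nat \<Rightarrow> bool) \<Rightarrow> nat" where
  "attempts_made H s = (LEAST k. 1 \<le> k \<and> (s k \<or> k = H))"

definition attempt_energy :: "real \<Rightarrow> real \<Rightarrow> real \<Rightarrow> real \<Rightarrow> real" where
  "attempt_energy P_t P_c Lbits R = (P_t + P_c) * (Lbits / R)"

text \<open>
  Realized energy over the horizon; \<^term>\<open>s n k\<close> is the outcome of attempt \<^term>\<open>k\<close> for
  packet \<^term>\<open>n\<close>, with packets numbered from 0.
\<close>

definition comm_energy ::
  "real \<Rightarrow> real \<Rightarrow> real \<Rightarrow> real \<Rightarrow> real \<Rightarrow> real \<Rightarrow> nat \<Rightarrow> nat \<Rightarrow> (nat \<Rightarrow> nat \<Rightarrow> bool) \<Rightarrow> real" where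
  "comm_energy P_t P_c P_i Lbits R T H N s =
     (\<Sum>n<N. \<Sum>k = 1..attempts_made H (s n). attempt_energy P_t P_c Lbits R) + P_i * T"

definition expected_comm_energy ::
  "'a measure \<Rightarrow> real \<Rightarrow> real \<Rightarrow> real \<Rightarrow> real \<Rightarrow> real \<Rightarrow> real \<Rightarrow> nat \<Rightarrow> nat
     \<Rightarrow> (nat \<Rightarrow> nat \<Rightarrow> 'a \<Rightarrow> bool) \<Rightarrow> real" where
  "expected_comm_energy M P_t P_c P_i Lbits R T H N S =
     (\<integral>\<omega>. comm_energy P_t P_c P_i Lbits R T H N (\<lambda>n k. S n k \<omega>) \<partial>M)"

end

theory Submission
  imports Defs
begin

text \<open>
  The number of attempts for a packet is a sum of tail indicators: attempt $j + 1$ is made iff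
  $j < H$ and the first $j$ attempts all failed, which has probability $(1 - \mathrm{PRR})^j$.
  By linearity the expected number of attempts is the geometric sum over $j < H$.
\<close>

lemma attempts_made_eq_sum_tails:
  assumes "1 \<le> H"
  shows "attempts_made H s = (\<Sum>j<H. of_bool (\<forall>k\<in>{1..j}. \<not> s k))"
proof -
  let ?P = "\<lambda>k. 1 \<le> k \<and> (s k \<or> k = H)"
  let ?m = "attempts_made H s"
  have "?P H" using assms by simp
  then have m: "?P ?m" and m_le: "?m \<le> H"
    unfolding attempts_made_def by (fact LeastI, fact Least_le)
  have below: "\<not> ?P k" if "k < ?m" for k
    using that not_less_Least unfolding attempts_made_def by blast
  have "j < ?m \<longleftrightarrow> j < H \<and> (\<forall>k\<in>{1..j}. \<not> s k)" for j
  proof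
    assume "j < ?m"
    then show "j < H \<and> (\<forall>k\<in>{1..j}. \<not> s k)"
      using m_le below by fastforce
  next
    assume "j < H \<and> (\<forall>k\<in>{1..j}. \<not> s k)"
    then show "j < ?m"
      using m by (metis atLeastAtMost_iff linorder_not_less)
  qed
  \<comment> \<open>The indices with nonzero indicator form exactly the initial segment below
    \<open>?m\<close>, so the indicator sum counts to \<open>?m\<close>.\<close>
  then have "{..<H} \<inter> {j. \<forall>k\<in>{1..j}. \<not> s k} = {..<?m}"
    by auto
  then show ?thesis
    by (simp add: sum.If_cases of_bool_def)
qed

context prob_space
begin

text \<open>Independence turns the joint failure probability into a product of \<open>card J\<close>
  equal factors, each the complement of a success probability.\<close>

lemma prob_all_fail:
  fixes X :: "'i \<Rightarrow> 'a \<Rightarrow> bool"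
  assumes indep: "indep_vars (\<lambda>_. count_space UNIV) X I"
    and J: "finite J" "J \<subseteq> I"
    and p: "\<And>i. i \<in> J \<Longrightarrow> prob {\<omega> \<in> space M. X i \<omega>} = p"
  shows "prob {\<omega> \<in> space M. \<forall>i\<in>J. \<not> X i \<omega>} = (1 - p) ^ card J"
\<comment> \<open>The product rule \<open>indep_varsD\<close> applies to nonempty index sets only.
  For \<open>J = {}\<close> the event is all of \<open>space M\<close>; this is the case of the
  first attempt, made with probability 1.\<close>
proof (cases "J = {}")
  case True
  then show ?thesis by (simp add: prob_space)
next
  case False
  have fail: "prob (X i -` {False} \<inter> space M) = 1 - p" if "i \<in> J" for i
  proof -
    have [measurable]: "X i \<in> measurable M (count_space UNIV)"
      using indep that J(2) by (auto simp: indep_vars_def)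
    have "X i -` {False} \<inter> space M = space M - {\<omega> \<in> space M. X i \<omega>}"
      by auto
    then show ?thesis
      using p[OF that] by (simp add: prob_compl)
  qed
  have "{\<omega> \<in> space M. \<forall>i\<in>J. \<not> X i \<omega>} = (\<Inter>i\<in>J. X i -` {False} \<inter> space M)"
    using False by auto
  also have "prob \<dots> = (\<Prod>i\<in>J. prob (X i -` {False} \<inter> space M))"
    using indep_varsD[OF indep False J] by simp
  finally show ?thesis
    by (simp add: fail)
qed

lemma indep_vars_reindex:
  assumes indep: "indep_vars M' X (f ` I)" and f: "inj_on f I"
  shows "indep_vars (M' \<circ> f) (X \<circ> f) I"
  unfolding indep_vars_def2
proof (intro conjI indep_setsI ballI)
  show "random_variable ((M' \<circ> f) i) ((X \<circ> f) i)" if "i \<in> I" for i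
    using indep that by (simp add: indep_vars_def)
  then show "{(X \<circ> f) i -` A \<inter> space M |A. A \<in> sets ((M' \<circ> f) i)} \<subseteq> events" if "i \<in> I" for i
    using that by (auto simp: measurable_sets)
next
  fix A J
  assume J: "J \<noteq> {}" "J \<subseteq> I" "finite J"
    and A: "\<forall>j\<in>J. A j \<in> {(X \<circ> f) j -` B \<inter> space M |B. B \<in> sets ((M' \<circ> f) j)}"
  then obtain B where B: "\<And>j. j \<in> J \<Longrightarrow> B j \<in> sets (M' (f j))"
      "\<And>j. j \<in> J \<Longrightarrow> A j = X (f j) -` B j \<inter> space M"
    by simp metis
  have inj: "inj_on f J" using f J(2) by (rule inj_on_subset)
  let ?C = "\<lambda>i. B (the_inv_into J f i)"
  have "prob (\<Inter>i\<in>f ` J. X i -` ?C i \<inter> space M) = (\<Prod>i\<in>f ` J. prob (X i -` ?C i \<inter> space M))"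
    using J B(1) by (intro indep_varsD[OF indep]) (auto simp: the_inv_into_f_f[OF inj])
  then show "prob (\<Inter>j\<in>J. A j) = (\<Prod>j\<in>J. prob (A j))"
    using J(1)
    by (simp add: prod.reindex[OF inj] the_inv_into_f_f[OF inj] B(2) cong: INF_cong)
qed

text \<open>Stated with \<open>has_bochner_integral\<close> so that integrability comes along with
  the value and linearity applies directly when packets are summed.\<close>

lemma has_bochner_integral_attempts_made:
  fixes s :: "nat \<Rightarrow> 'a \<Rightarrow> bool"
  assumes "1 \<le> H" and "p \<noteq> 0"
    and indep: "indep_vars (\<lambda>_. count_space UNIV) s {1..H}"
    and p: "\<And>k. k \<in> {1..H} \<Longrightarrow> prob {\<omega> \<in> space M. s k \<omega>} = p"
  shows "has_bochner_integral M (\<lambda>\<omega>. real (attempts_made H (\<lambda>k. s k \<omega>)))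
    ((1 - (1 - p) ^ H) / p)"
proof -
  let ?F = "\<lambda>j. {\<omega> \<in> space M. \<forall>k\<in>{1..j}. \<not> s k \<omega>}"
  have tail: "has_bochner_integral M (indicat_real (?F j)) ((1 - p) ^ j)" if "j < H" for j
  proof -
    have meas[measurable]: "s k \<in> measurable M (count_space UNIV)" if "k \<in> {1..j}" for k
      using indep that \<open>j < H\<close> by (auto simp: indep_vars_def)
    have "?F j \<in> sets M" by measurable
    moreover have "prob (?F j) = (1 - p) ^ card {1..j}"
      using \<open>j < H\<close> p by (intro prob_all_fail[OF indep]) auto
    ultimately show ?thesis
      using has_bochner_integral_real_indicator[of "?F j" M]
      by (simp add: emeasure_eq_measure)
  qed
  have "has_bochner_integral M (\<lambda>\<omega>. \<Sum>j<H. indicat_real (?F j) \<omega>) (\<Sum>j<H. (1 - p) ^ j)"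
    by (intro has_bochner_integral_sum tail) simp
  \<comment> \<open>Geometric sum with ratio \<open>1 - p\<close>, which differs from 1 because
    \<open>p \<noteq> 0\<close>.\<close>
  also have "(\<Sum>j<H. (1 - p) ^ j) = (1 - (1 - p) ^ H) / p"
    using \<open>p \<noteq> 0\<close> sum_gp_strict[of "1 - p" H] by simp
  finally show ?thesis
    by (rule has_bochner_integral_cong[THEN iffD1, rotated 3])
      (simp_all add: attempts_made_eq_sum_tails[OF \<open>1 \<le> H\<close>] indicator_def)
qed

end

theorem lemma3:
  fixes M :: "'a measure"
    and S :: "nat \<Rightarrow> nat \<Rightarrow> 'a \<Rightarrow> bool"
    and pps T Lbits R P_t P_c P_i PRR :: real
    and H N_pkt :: nat
  assumes "prob_space M"
    and "pps > 0" and "T > 0"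
    and "real N_pkt = pps * T"
    and "Lbits > 0" and "R > 0"
    and "P_t > 0" and "P_c \<ge> 0" and "P_i \<ge> 0"
    and "H \<ge> 1"
    and "0 < PRR" and "PRR \<le> 1"
    and "prob_space.indep_vars M (\<lambda>_. count_space UNIV) (\<lambda>(n, k). S n k) ({..<N_pkt} \<times> {1..H})"
    and "\<And>n k. n < N_pkt \<Longrightarrow> k \<in> {1..H} \<Longrightarrow> measure M {\<omega> \<in> space M. S n k \<omega>} = PRR"
  shows "expected_comm_energy M P_t P_c P_i Lbits R T H N_pkt S =
    real N_pkt * ((P_t + P_c) * (Lbits / R) * ((1 - (1 - PRR) ^ H) / PRR) + P_i / pps)"
proof -
  interpret prob_space M by fact
  let ?e = "attempt_energy P_t P_c Lbits R"
  let ?A = "\<lambda>n \<omega>. real (attempts_made H (\<lambda>k. S n k \<omega>))"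
  let ?g = "(1 - (1 - PRR) ^ H) / PRR"
  have A: "has_bochner_integral M (?A n) ?g" if "n < N_pkt" for n
  proof -
    \<comment> \<open>Restrict the joint family to the slice of packet \<open>n\<close>, written as
      the image of \<open>{1..H}\<close> under the injection \<open>Pair n\<close>, then reindex by
      the attempt number.\<close>
    have "indep_vars (\<lambda>_. count_space UNIV) (S n) {1..H}"
      using indep_vars_reindex[OF indep_vars_subset[OF assms(13), of "Pair n ` {1..H}"]] that
      by (auto simp: inj_on_def comp_def)
    then show ?thesis
      using assms that by (intro has_bochner_integral_attempts_made) auto
  qed
  have idle: "has_bochner_integral M (\<lambda>_. P_i * T) (P_i * T)"
    using has_bochner_integral_integrable[OF integrable_const[of "P_i * T"]] by (simp add: prob_space)
  have "has_bochner_integral M (\<lambda>\<omega>. (\<Sum>n<N_pkt. ?A n \<omega> * ?e) + P_i * T)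
      ((\<Sum>n<N_pkt. ?g * ?e) + P_i * T)"
    by (intro has_bochner_integral_add[OF _ idle] has_bochner_integral_sum
        has_bochner_integral_mult_left A) simp
  then have "expected_comm_energy M P_t P_c P_i Lbits R T H N_pkt S = real N_pkt * (?g * ?e) + P_i * T"
    unfolding expected_comm_energy_def comm_energy_def
    by (simp add: has_bochner_integral_integral_eq)
  \<comment> \<open>Spreads the idle energy evenly over the \<open>pps * T\<close> packets, each
    bearing \<open>P_i / pps\<close>.\<close>
  moreover have "P_i * T = real N_pkt * (P_i / pps)"
    using assms(2,4) by simp
  ultimately show ?thesis
    by (simp add: attempt_energy_def algebra_simps)
qed

end
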